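(* For all integers $n\geq 0$, \begin{align*} \overline{R_3^\ast}(9n+4)&\equiv 0 \pmod{12},\\ \overline{R_3^\ast}(9n+7)&\equiv 0 \pmod{48},\\ \overline{R_6^\ast}(9n+5)&\equiv 0 \pmod{24},\\ \overline{R_6^\ast}(9n+8)&\equiv 0 \pmod{96}. \end{align*}
   Context: An overpartition of $n$ is a partition of $n$ (a non-increasing sequence of positive integers summing to $n$) in which the first occurrence of each part size may optionally be overlined. For a positive integer $\ell$, $\overline{R_\ell^\ast}(n)$ denotes the number of overpartitions of $n$ in which no non-overlined part is divisible by $\ell$. Equivalently, with $f_k:=\prod_{i\geq 1}(1-q^{ki})$, one has $\sum_{n\geq 0}\overline{R_\ell^\ast}(n)q^n = \frac{f_2 f_\ell}{f_1^2}$. *)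

theory Defs
  imports Main "HOL-Number_Theory.Cong"
begin

text \<open>A part is a pair \<open>(k, b)\<close> of its size \<open>k\<close> and a flag \<open>b\<close> telling whether it is overlined.\<close>

definition overpartition_of :: "nat \<Rightarrow> (nat \<times> bool) list \<Rightarrow> bool" where
  "overpartition_of n xs \<longleftrightarrow>
     sorted_wrt (\<ge>) (map fst xs) \<and>
     (\<forall>p \<in> set xs. fst p > 0) \<and>
     sum_list (map fst xs) = n \<and>
     (\<forall>j < length xs. snd (xs ! j) \<longrightarrow> (\<forall>i < j. fst (xs ! i) \<noteq> fst (xs ! j)))"

definition Rstar_overpartitions :: "nat \<Rightarrow> nat \<Rightarrow> (nat \<times> bool) list set" where
  "Rstar_overpartitions l n =
     {xs. overpartition_of n xs \<and> (\<forall>p \<in> set xs. \<not> snd p \<longrightarrow> \<not> l dvd fst p)}"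

definition Rstar :: "nat \<Rightarrow> nat \<Rightarrow> nat" where
  "Rstar l n = card (Rstar_overpartitions l n)"

text \<open>The counted set is finite, so the cardinality is a genuine count.\<close>

lemma length_le_sum_list_pos:
  fixes ys :: "nat list"
  shows "(\<forall>y \<in> set ys. y > 0) \<Longrightarrow> length ys \<le> sum_list ys"
  by (induction ys) auto

lemma finite_Rstar_overpartitions: "finite (Rstar_overpartitions l n)"
proof (rule finite_subset)
  show "Rstar_overpartitions l n \<subseteq> {xs. set xs \<subseteq> {..n} \<times> UNIV \<and> length xs \<le> n}"
  proof
    fix xs assume "xs \<in> Rstar_overpartitions l n"
    then have pos: "\<forall>y \<in> set (map fst xs). y > 0" and sum: "sum_list (map fst xs) = n"
      by (auto simp: Rstar_overpartitions_def overpartition_of_def)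
    have "length xs \<le> n"
      using length_le_sum_list_pos[OF pos] sum by simp
    moreover have "fst p \<le> n" if "p \<in> set xs" for p
      using member_le_sum_list[of "fst p" "map fst xs"] that sum by auto
    ultimately show "xs \<in> {xs. set xs \<subseteq> {..n} \<times> UNIV \<and> length xs \<le> n}"
      by force
  qed
  show "finite {xs :: (nat \<times> bool) list. set xs \<subseteq> {..n} \<times> UNIV \<and> length xs \<le> n}"
    by (rule finite_lists_length_le) simp
qed

end

theory Submission
  imports Defs "HOL-Computational_Algebra.Formal_Laurent_Series"
begin

text \<open>
  Write \<open>f\<^sub>k = \<Prod>(1 - q\<^bsup>ki\<^esup>)\<close>. Since \<open>f\<^sub>1\<^sup>2 / f\<^sub>2 = \<phi>(-q) = \<Sum>(-1)\<^sup>j q\<^bsup>j\<^sup>2\<^esup>\<close>, the generating function is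
  \<open>R\<^sub>l = f\<^sub>l / \<phi>(-q)\<close>. Splitting the exponents \<open>j\<^sup>2\<close> modulo 3 gives \<open>\<phi>(-q) = a(q\<^sup>3) - q b(q\<^sup>3)\<close>
  with \<open>b = 2 \<Omega>\<close> even, and the product formulas for \<open>\<phi>\<close> and \<open>\<Omega>\<close> (Jacobi's triple product) show that
  the coefficients of \<open>R\<^sub>3\<close> at \<open>3n + 1\<close> have generating function \<open>2 (f\<^sub>3 / \<phi>(-q))\<^sup>3\<close>, and those of \<open>R\<^sub>6\<close> at
  \<open>3n + 2\<close> have \<open>4 (f\<^sub>6 / \<phi>(-q))\<^sup>3\<close>. With \<open>w = q b(q\<^sup>3)\<close>, one expands
  \<open>1 / (a - w)\<^sup>3 = (a\<^sup>2 + a w + w\<^sup>2)\<^sup>3 / (a\<^sup>3 - w\<^sup>3)\<^sup>3\<close>, where the denominator only involves \<open>q\<^sup>3\<close>. In the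
  numerator the exponents 1 modulo 3 contribute \<open>3 a\<^sup>2 w (a\<^sup>3 + 2 w\<^sup>3)\<close>, a multiple of 6, and the exponents 2
  modulo 3 contribute \<open>3 a w\<^sup>2 (2 a\<^sup>3 + w\<^sup>3)\<close>, a multiple of 24.
\<close>

unbundle fps_syntax

section \<open>Generating function of the overpartitions\<close>

definition parts_upto :: "nat \<Rightarrow> nat \<Rightarrow> nat \<Rightarrow> (nat \<times> bool) list set" where
  "parts_upto l m n = {xs \<in> Rstar_overpartitions l n. \<forall>p\<in>set xs. fst p \<le> m}"

text \<open>Once the first copy of the part \<open>m\<close> has been removed, no further copy of
  \<open>m\<close> may be overlined, so the rest of the list lies in this class.\<close>

definition parts_upto_plain :: "nat \<Rightarrow> nat \<Rightarrow> nat \<Rightarrow> (nat \<times> bool) list set" where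
  "parts_upto_plain l m n = {xs \<in> parts_upto l m n. (m, True) \<notin> set xs}"

lemma Nil_in_Rstar_overpartitions: "[] \<in> Rstar_overpartitions l n \<longleftrightarrow> n = 0"
  by (auto simp: Rstar_overpartitions_def overpartition_of_def)

text \<open>The head has no predecessor, so its own flag is unrestricted by position; it only
  forbids later overlined parts of the same size. This turns the index condition into a recursion on
  lists.\<close>

lemma Cons_in_Rstar_overpartitions:
  "(x # xs) \<in> Rstar_overpartitions l n \<longleftrightarrow>
     0 < fst x \<and> fst x \<le> n \<and> (\<forall>p\<in>set xs. fst p \<le> fst x) \<and>
     (\<forall>p\<in>set xs. snd p \<longrightarrow> fst p \<noteq> fst x) \<and> (\<not> snd x \<longrightarrow> \<not> l dvd fst x) \<and>
     xs \<in> Rstar_overpartitions l (n - fst x)"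
proof -
  have "(\<forall>j < length (x # xs). snd ((x # xs) ! j) \<longrightarrow> (\<forall>i < j. fst ((x # xs) ! i) \<noteq> fst ((x # xs) ! j)))
    \<longleftrightarrow> (\<forall>j < length xs. snd (xs ! j) \<longrightarrow> fst x \<noteq> fst (xs ! j) \<and> (\<forall>i < j. fst (xs ! i) \<noteq> fst (xs ! j)))"
    by (simp add: All_less_Suc2)
  also have "\<dots> \<longleftrightarrow> (\<forall>p\<in>set xs. snd p \<longrightarrow> fst p \<noteq> fst x) \<and>
      (\<forall>j < length xs. snd (xs ! j) \<longrightarrow> (\<forall>i < j. fst (xs ! i) \<noteq> fst (xs ! j)))"
    unfolding all_set_conv_all_nth by metis
  finally show ?thesis
    unfolding Rstar_overpartitions_def overpartition_of_def by auto
qed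

lemma parts_upto_Suc:
  assumes "k = Suc m"
  shows "parts_upto l k n = parts_upto l m n \<union>
     (if k \<le> n then Cons (k, True) ` parts_upto_plain l k (n - k) \<union>
       (if l dvd k then {} else Cons (k, False) ` parts_upto_plain l k (n - k)) else {})"
    (is "_ = ?R")
proof (rule set_eqI)
  fix xs show "xs \<in> parts_upto l k n \<longleftrightarrow> xs \<in> ?R"
  proof (cases xs)
    case Nil
    then show ?thesis by (auto simp: parts_upto_def)
  next
    case (Cons x ys)
    obtain s b where x: "x = (s, b)" by (cases x)
    consider "s < k" | "s = k" | "s > k" by linarith
    then show ?thesis
    proof cases
      case 1
      then have "(\<forall>p\<in>set ys. fst p \<le> s) \<Longrightarrow> (\<forall>p\<in>set ys. fst p \<le> k) \<and> (\<forall>p\<in>set ys. fst p \<le> m)"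
        using assms by (meson less_Suc_eq_le less_imp_le order_trans)
      moreover have "s \<le> k" "s \<le> m" using 1 assms by auto
      ultimately have "xs \<in> parts_upto l k n \<longleftrightarrow> xs \<in> parts_upto l m n"
        unfolding Cons x parts_upto_def mem_Collect_eq Cons_in_Rstar_overpartitions
          list.set ball_simps fst_conv by blast
      then show ?thesis using Cons x 1 by auto
    next
      case 2
      then show ?thesis using Cons x assms
        by (cases b) (auto simp: parts_upto_def parts_upto_plain_def Cons_in_Rstar_overpartitions
              image_iff)
    next
      case 3
      then show ?thesis using Cons x assms
        by (auto simp: parts_upto_def)
    qed
  qed
qed

lemma parts_upto_plain_Suc:
  assumes "k = Suc m"
  shows "parts_upto_plain l k n = parts_upto l m n \<union>
     (if k \<le> n \<and> \<not> l dvd k then Cons (k, False) ` parts_upto_plain l k (n - k) else {})"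
proof -
  have "(k, True) \<notin> set xs" if "xs \<in> parts_upto l m n" for xs
    using that assms by (auto simp: parts_upto_def)
  then show ?thesis
    unfolding parts_upto_plain_def[of l k n] parts_upto_Suc[OF assms]
    by (auto simp: parts_upto_plain_def)
qed

lemma finite_parts_upto: "finite (parts_upto l m n)" "finite (parts_upto_plain l m n)"
  unfolding parts_upto_plain_def parts_upto_def using finite_Rstar_overpartitions by auto

text \<open>If \<open>k\<close> occurs, it is the head of the list, and removing it leaves a list of
  the plain class. The factor counts the admissible flags of the head: only overlined if
  \<open>l dvd k\<close>, both otherwise.\<close>

lemma card_parts_upto_Suc:
  assumes "k = Suc m"
  shows "card (parts_upto l k n) = card (parts_upto l m n) +
     (if k \<le> n then (if l dvd k then 1 else 2) * card (parts_upto_plain l k (n - k)) else 0)"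
    (is ?A)
   and "card (parts_upto_plain l k n) = card (parts_upto l m n) +
     (if k \<le> n \<and> \<not> l dvd k then card (parts_upto_plain l k (n - k)) else 0)" (is ?B)
proof -
  let ?C = "\<lambda>b. Cons (k, b) ` parts_upto_plain l k (n - k)"
  have *: "parts_upto l m n \<inter> ?C b = {}" "card (?C b) = card (parts_upto_plain l k (n - k))" for b
    using assms by (auto simp: parts_upto_def card_image)
  have "card (?C True \<union> ?C False) = 2 * card (parts_upto_plain l k (n - k))"
    by (subst card_Un_disjoint) (auto simp: finite_parts_upto *)
  then show ?A unfolding parts_upto_Suc[OF assms]
    by (auto simp: card_Un_disjoint finite_parts_upto * Int_Un_distrib)
  show ?B
    by (subst parts_upto_plain_Suc[OF assms])
      (auto simp: card_Un_disjoint finite_parts_upto *)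
qed

lemma card_parts_upto_0: "card (parts_upto l 0 n) = (if n = 0 then 1 else 0)"
proof -
  have "parts_upto l 0 n = (if n = 0 then {[]} else {})"
  proof (rule set_eqI)
    fix xs show "xs \<in> parts_upto l 0 n \<longleftrightarrow> xs \<in> (if n = 0 then {[]} else {})"
    proof (cases xs)
      case (Cons x ys)
      then have "xs \<notin> parts_upto l 0 n"
        unfolding parts_upto_def mem_Collect_eq Cons Cons_in_Rstar_overpartitions list.set ball_simps by auto
      then show ?thesis using Cons by simp
    qed (simp add: parts_upto_def Nil_in_Rstar_overpartitions)
  qed
  then show ?thesis by simp
qed

lemma parts_upto_eq:
  assumes "n \<le> m"
  shows "parts_upto l m n = Rstar_overpartitions l n"
proof -
  have "fst p \<le> m" if "xs \<in> Rstar_overpartitions l n" "p \<in> set xs" for xs p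
    using that assms member_le_sum_list[of "fst p" "map fst xs"]
    by (auto simp: Rstar_overpartitions_def overpartition_of_def)
  then show ?thesis by (auto simp: parts_upto_def)
qed

lemma gf_parts_upto:
  fixes G :: "nat \<Rightarrow> int fps"
  assumes G: "\<And>m. G m = Abs_fps (\<lambda>n. int (card (parts_upto l m n)))"
  shows "G m * (\<Prod>i<m. 1 - fps_X ^ Suc i) =
      (\<Prod>i<m. (1 + fps_X ^ Suc i) * (if l dvd Suc i then 1 - fps_X ^ Suc i else 1))"
proof (induction m)
  case 0
  show ?case by (auto simp: G card_parts_upto_0 fps_eq_iff)
next
  case (Suc m)
  define H where "H = Abs_fps (\<lambda>n. int (card (parts_upto_plain l (Suc m) n)))"
  define Q :: "int fps" where "Q = fps_X ^ Suc m"
  \<comment> \<open>\<open>Q\<close> marks one copy of the part \<open>Suc m\<close>. Eliminating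
    \<open>H\<close> from the two recurrences multiplies \<open>G m\<close> by
    \<open>(1 + Q) / (1 - Q)\<close>, or by \<open>1 + Q\<close> if \<open>l dvd Suc m\<close>; the
    claim clears these denominators.\<close>
  have 1: "G (Suc m) = G m + (if l dvd Suc m then 1 else 2) * (Q * H)"
    by (rule fps_ext) (auto simp: G H_def Q_def card_parts_upto_Suc(1)[OF refl] fps_X_power_mult_nth
        numeral_fps_const simp del: power_Suc)
  have 2: "H = G m + (if l dvd Suc m then 0 else Q * H)"
  proof (rule fps_ext)
    fix n
    show "H $ n = (G m + (if l dvd Suc m then 0 else Q * H)) $ n"
      using card_parts_upto_Suc(2)[of "Suc m" m l n]
      by (auto simp: G H_def Q_def fps_X_power_mult_nth simp del: power_Suc)
  qed
  have "G (Suc m) * (1 - Q) = G m * ((1 + Q) * (if l dvd Suc m then 1 - Q else 1))"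
  proof (cases "l dvd Suc m")
    case True
    then show ?thesis using 1 2 by (simp add: algebra_simps)
  next
    case False
    then have "H * (1 - Q) = G m" "G (Suc m) = G m + 2 * (Q * H)" using 1 2 by (auto simp: algebra_simps)
    then have "G (Suc m) * (1 - Q) = G m * (1 - Q) + 2 * Q * (H * (1 - Q))"
      by (simp add: algebra_simps)
    also note \<open>H * (1 - Q) = G m\<close>
    finally have "G (Suc m) * (1 - Q) = G m * (1 - Q) + 2 * Q * G m" .
    then show ?thesis using False by (simp add: algebra_simps)
  qed
  then have "G (Suc m) * (1 - Q) * (\<Prod>i<m. 1 - fps_X ^ Suc i) =
      G m * ((1 + Q) * (if l dvd Suc m then 1 - Q else 1)) * (\<Prod>i<m. 1 - fps_X ^ Suc i)"
    by simp
  then show ?case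
    unfolding prod.lessThan_Suc Suc.IH[symmetric] Q_def[symmetric] by (simp only: ac_simps)
qed

section \<open>Congruence of series modulo powers of X, and Euler products\<close>

definition fps_agree :: "nat \<Rightarrow> int fps \<Rightarrow> int fps \<Rightarrow> bool" where
  "fps_agree N f g \<longleftrightarrow> (\<forall>i<N. f $ i = g $ i)"

lemma fps_agree_refl [simp]: "fps_agree N f f"
  by (simp add: fps_agree_def)

lemma fps_agree_sym: "fps_agree N f g \<Longrightarrow> fps_agree N g f"
  by (simp add: fps_agree_def)

lemma fps_agree_trans [trans]: "fps_agree N f g \<Longrightarrow> fps_agree N g h \<Longrightarrow> fps_agree N f h"
  by (simp add: fps_agree_def)

text \<open>Without these rules, \<open>also\<close> falls back on the slow higher-order unification of the substitution rules.\<close>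
lemma fps_agree_eq_trans [trans]:
  "fps_agree N f g \<Longrightarrow> g = h \<Longrightarrow> fps_agree N f h"
  "f = g \<Longrightarrow> fps_agree N g h \<Longrightarrow> fps_agree N f h"
  by simp_all

lemma fps_agree_mono: "fps_agree N f g \<Longrightarrow> M \<le> N \<Longrightarrow> fps_agree M f g"
  by (simp add: fps_agree_def)

lemma fps_agree_mult: "fps_agree N f g \<Longrightarrow> fps_agree N f' g' \<Longrightarrow> fps_agree N (f * f') (g * g')"
  by (auto simp: fps_agree_def fps_mult_nth intro!: sum.cong)

lemma fps_agree_power: "fps_agree N f g \<Longrightarrow> fps_agree N (f ^ k) (g ^ k)"
  by (induction k) (auto intro: fps_agree_mult)

lemma fps_agree_sum: "(\<And>i. i \<in> I \<Longrightarrow> fps_agree N (f i) (g i)) \<Longrightarrow> fps_agree N (sum f I) (sum g I)"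
  by (auto simp: fps_agree_def fps_sum_nth intro!: sum.cong)

lemma fps_agree_X_power_mult: "fps_agree (N - k) f g \<Longrightarrow> fps_agree N (fps_X ^ k * f) (fps_X ^ k * g)"
  by (auto simp: fps_agree_def fps_X_power_mult_nth)

lemma fps_agree_ext: "(\<And>N. fps_agree N f g) \<Longrightarrow> f = g"
  unfolding fps_agree_def by (intro fps_ext) blast

definition Euler_prod :: "nat \<Rightarrow> nat \<Rightarrow> int fps" where
  "Euler_prod k N = (\<Prod>i<N. 1 - fps_X ^ (k * Suc i))"

text \<open>For \<open>k > 0\<close> the factors from index \<open>n\<close> on do not affect
  coefficient \<open>n\<close>, so this diagonal of the partial products is the infinite product
  \<open>f\<^sub>k\<close>.\<close>

definition Euler_fun :: "nat \<Rightarrow> int fps" where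
  "Euler_fun k = Abs_fps (\<lambda>n. Euler_prod k n $ n)"

lemma Euler_prod_0 [simp]: "Euler_prod k 0 = 1"
  by (simp add: Euler_prod_def)

lemma Euler_prod_Suc: "Euler_prod k (Suc N) = Euler_prod k N * (1 - fps_X ^ (k * Suc N))"
  by (simp add: Euler_prod_def)

lemma Euler_prod_agree:
  assumes "N \<le> M"
  shows "fps_agree (k * Suc N) (Euler_prod k M) (Euler_prod k N)"
  using assms
proof (induction M rule: dec_induct)
  case (step M)
  have "k * Suc N \<le> k * Suc M" using step by (intro mult_le_mono) auto
  then have "fps_agree (k * Suc N) (1 - fps_X ^ (k * Suc M)) 1"
    by (auto simp: fps_agree_def)
  from fps_agree_mult[OF step.IH this] show ?case by (simp add: Euler_prod_Suc)
qed simp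

lemma Euler_fun_agree:
  assumes "k > 0"
  shows "fps_agree (k * Suc N) (Euler_fun k) (Euler_prod k N)"
  unfolding fps_agree_def
proof (intro allI impI)
  fix n assume n: "n < k * Suc N"
  have n': "n < k * Suc n" using assms by (cases k) auto
  show "Euler_fun k $ n = Euler_prod k N $ n"
    using Euler_prod_agree[of N n k] Euler_prod_agree[of n N k] n n'
    by (cases "N \<le> n") (auto simp: Euler_fun_def fps_agree_def)
qed

lemma Euler_fun_agree':
  assumes "k > 0" "N \<le> M"
  shows "fps_agree N (Euler_prod k M) (Euler_fun k)"
proof -
  have "N \<le> k * Suc M" using assms by (cases k) auto
  with Euler_fun_agree[OF assms(1), of M] show ?thesis
    by (meson fps_agree_mono fps_agree_sym)
qed

lemma Euler_fun_nth_0 [simp]: "Euler_fun k $ 0 = 1"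
  by (simp add: Euler_fun_def)

lemma Euler_fun_nonzero [simp]: "Euler_fun k \<noteq> 0"
  using Euler_fun_nth_0[of k] by (metis fps_zero_nth zero_neq_one)

theorem Rstar_gf:
  assumes "l > 0"
  shows "Abs_fps (\<lambda>n. int (Rstar l n)) * Euler_fun 1 ^ 2 = Euler_fun 2 * Euler_fun l"
proof (rule fps_agree_ext)
  fix N
  define G where "G m = Abs_fps (\<lambda>n. int (card (parts_upto l m n)))" for m
  \<comment> \<open>With this cutoff the multiples of \<open>l\<close> among the sizes 1 to
    \<open>M\<close> are exactly l, 2l, ..., Nl, so the factors selected by divisibility form
    \<open>Euler_prod l N\<close>.\<close>
  define M where "M = l * N"
  have NM: "N \<le> M" using assms by (auto simp: M_def)
  have "fps_agree N (Abs_fps (\<lambda>n. int (Rstar l n))) (G M)"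
    using NM by (auto simp: fps_agree_def G_def Rstar_def parts_upto_eq)
  then have "fps_agree N (Abs_fps (\<lambda>n. int (Rstar l n)) * Euler_fun 1 ^ 2) (G M * Euler_prod 1 M ^ 2)"
    using NM by (intro fps_agree_mult fps_agree_power fps_agree_sym[OF Euler_fun_agree']) auto
  also have "G M * Euler_prod 1 M ^ 2 = (\<Prod>i<M. (1 + fps_X ^ Suc i) * (if l dvd Suc i then 1 - fps_X ^ Suc i else 1))
      * (\<Prod>i<M. 1 - fps_X ^ Suc i)"
    unfolding gf_parts_upto[OF G_def, symmetric] by (simp add: Euler_prod_def power2_eq_square)
  also have "\<dots> = (\<Prod>i<M. (1 - fps_X ^ (2 * Suc i))) * (\<Prod>i<M. if l dvd Suc i then 1 - fps_X ^ Suc i else 1)"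
    unfolding prod.distrib[symmetric]
    by (intro prod.cong refl) (simp add: algebra_simps power_add[symmetric] mult_2 del: power_Suc)
  also have "(\<Prod>i<M. if l dvd Suc i then 1 - fps_X ^ Suc i else (1 :: int fps)) = Euler_prod l N"
  proof -
    have "(\<Prod>i<M. if l dvd Suc i then 1 - fps_X ^ Suc i else (1 :: int fps))
        = (\<Prod>i\<in>{i\<in>{..<M}. l dvd Suc i}. 1 - fps_X ^ Suc i)"
      by (rule prod.inter_filter[symmetric]) simp
    also have "\<dots> = Euler_prod l N"
      unfolding Euler_prod_def
    proof (rule prod.reindex_bij_witness[where i = "\<lambda>i. l * Suc i - 1" and j = "\<lambda>i. Suc i div l - 1"])
      fix i assume "i \<in> {i \<in> {..<M}. l dvd Suc i}"
      then obtain j where j: "Suc i = l * Suc j" and i: "i < M"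
        by (metis (no_types, lifting) dvd_def mem_Collect_eq lessThan_iff nat.distinct(1) mult_0_right not0_implies_Suc)
      then have "l * Suc j \<le> l * N" by (simp add: M_def)
      then show "l * Suc (Suc i div l - 1) - 1 = i" "Suc i div l - 1 \<in> {..<N}"
        "1 - fps_X ^ (l * Suc (Suc i div l - 1)) = (1 - fps_X ^ Suc i :: int fps)"
        using j assms by (auto simp del: mult_Suc_right power_Suc)
    next
      fix i assume "i \<in> {..<N}"
      then have "l * Suc i \<le> l * N" "0 < l * Suc i" using assms by (auto simp del: mult_Suc_right intro: mult_le_mono2)
      then have "l * Suc i - 1 < l * N" by linarith
      then show "l * Suc i - 1 \<in> {i \<in> {..<M}. l dvd Suc i}" "Suc (l * Suc i - 1) div l - 1 = i"
        using assms by (auto simp: M_def simp del: mult_Suc_right)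
    qed
    finally show ?thesis .
  qed
  also have "fps_agree N ((\<Prod>i<M. (1 - fps_X ^ (2 * Suc i))) * Euler_prod l N) (Euler_fun 2 * Euler_fun l)"
    unfolding Euler_prod_def[symmetric] using NM assms by (intro fps_agree_mult Euler_fun_agree') auto
  finally show "fps_agree N (Abs_fps (\<lambda>n. int (Rstar l n)) * Euler_fun 1 ^ 2) (Euler_fun 2 * Euler_fun l)" .
qed

section \<open>Jacobi triple product\<close>

text \<open>Gaussian binomial coefficients, defined by the q-Pascal rule so that they exist in any
  commutative ring without division.\<close>

fun qbinom :: "'a::comm_ring_1 \<Rightarrow> nat \<Rightarrow> nat \<Rightarrow> 'a" where
  "qbinom q n 0 = 1"
| "qbinom q 0 (Suc k) = 0"
| "qbinom q (Suc n) (Suc k) = qbinom q n k + q ^ Suc k * qbinom q n (Suc k)"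

lemma qbinom_eq_0: "n < k \<Longrightarrow> qbinom q n k = 0"
  by (induction q n k rule: qbinom.induct) auto

lemma Suc_choose_two: "Suc k choose 2 = (k choose 2) + k"
  by (simp add: numeral_2_eq_2)

text \<open>The factor at \<open>i = 0\<close> is split off, which replaces \<open>x\<close> by
  \<open>x * q\<close> in the rest; the two resulting sums recombine by the q-Pascal rule. The
  second variable \<open>y\<close> later keeps all exponents nonnegative.\<close>

theorem q_binomial:
  "(\<Prod>i<n. y + x * q ^ i) = (\<Sum>k\<le>n. q ^ (k choose 2) * qbinom q n k * x ^ k * y ^ (n - k))"
proof (induction n arbitrary: x)
  case 0
  show ?case by (simp add: numeral_2_eq_2)
next
  case (Suc n)
  define t where "t k = q ^ (k choose 2) * qbinom q n k * (x * q) ^ k" for k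
  have "(\<Prod>i<Suc n. y + x * q ^ i) = (y + x) * (\<Prod>i<n. y + (x * q) * q ^ i)"
    by (simp only: prod.lessThan_Suc_shift) (simp add: mult.assoc)
  also have "\<dots> = y * (\<Sum>k\<le>n. t k * y ^ (n - k)) + x * (\<Sum>k\<le>n. t k * y ^ (n - k))"
    unfolding Suc.IH t_def distrib_right ..
  also have "y * (\<Sum>k\<le>n. t k * y ^ (n - k)) = (\<Sum>k\<le>n. t k * y ^ (Suc n - k))"
    by (auto simp: sum_distrib_left Suc_diff_le algebra_simps intro!: sum.cong)
  also have "\<dots> = (\<Sum>k\<le>Suc n. t k * y ^ (Suc n - k))"
    by (simp add: t_def qbinom_eq_0)
  also have "\<dots> = y ^ Suc n + (\<Sum>k\<le>n. t (Suc k) * y ^ (n - k))"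
    by (simp only: sum.atMost_Suc_shift) (simp add: t_def numeral_2_eq_2)
  also have "y ^ Suc n + (\<Sum>k\<le>n. t (Suc k) * y ^ (n - k)) + x * (\<Sum>k\<le>n. t k * y ^ (n - k))
      = y ^ Suc n + (\<Sum>k\<le>n. (t (Suc k) + x * t k) * y ^ (n - k))"
    by (simp add: sum_distrib_left sum.distrib algebra_simps)
  also have "(\<Sum>k\<le>n. (t (Suc k) + x * t k) * y ^ (n - k)) =
      (\<Sum>k\<le>n. q ^ (Suc k choose 2) * qbinom q (Suc n) (Suc k) * x ^ Suc k * y ^ (n - k))"
  proof (intro sum.cong refl arg_cong2[where f = "(*)"])
    fix k
    show "t (Suc k) + x * t k = q ^ (Suc k choose 2) * qbinom q (Suc n) (Suc k) * x ^ Suc k"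
      by (simp add: t_def Suc_choose_two power_mult_distrib power_add algebra_simps)
  qed
  also have "y ^ Suc n + \<dots> = (\<Sum>k\<le>Suc n. q ^ (k choose 2) * qbinom q (Suc n) k * x ^ k * y ^ (Suc n - k))"
    by (subst sum.atMost_Suc_shift) (simp add: numeral_2_eq_2)
  finally show ?case .
qed

text \<open>The quotient formula for Gaussian binomials with denominators cleared. The induction
  combines the q-Pascal rule with \<open>1 - q ^ Suc n = (1 - q ^ Suc j) + q ^ Suc j * (1 - q ^ (n -
  j))\<close>.\<close>

lemma qbinom_Euler_prod:
  assumes "k \<le> n"
  shows "qbinom (fps_X ^ c) n k * (Euler_prod c k * Euler_prod c (n - k)) = Euler_prod c n"
  using assms
proof (induction n arbitrary: k)
  case 0
  then show ?case by simp
next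
  case (Suc n)
  define q :: "int fps" where "q = fps_X ^ c"
  have P: "Euler_prod c (Suc j) = Euler_prod c j * (1 - q ^ Suc j)" for j
    by (simp only: Euler_prod_Suc q_def power_mult)
  show ?case
  proof (cases k)
    case (Suc j)
    show ?thesis
    proof (cases "j = n")
      case True
      then show ?thesis using Suc.IH[of n] Suc
        by (simp add: qbinom_eq_0 P q_def[symmetric] mult.assoc[symmetric] del: power_Suc)
    next
      case False
      then have j: "j < n" using Suc Suc.prems by simp
      then have nj: "n - j = Suc (n - Suc j)" by simp
      have pw: "q ^ Suc n = q ^ Suc j * q ^ (n - j)"
        unfolding power_add[symmetric] using j by simp
      have "qbinom q (Suc n) (Suc j) * (Euler_prod c (Suc j) * Euler_prod c (n - j))
          = (qbinom q n j * (Euler_prod c j * Euler_prod c (n - j))) * (1 - q ^ Suc j)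
           + q ^ Suc j * (qbinom q n (Suc j) * (Euler_prod c (Suc j) * Euler_prod c (n - Suc j))) * (1 - q ^ (n - j))"
        unfolding qbinom.simps nj P by (simp add: algebra_simps del: power_Suc)
      also have "\<dots> = Euler_prod c n * (1 - q ^ Suc j) + q ^ Suc j * Euler_prod c n * (1 - q ^ (n - j))"
        using Suc.IH[of j] Suc.IH[of "Suc j"] j unfolding q_def by simp
      also have "\<dots> = Euler_prod c (Suc n)"
        unfolding P pw by (simp add: algebra_simps del: power_Suc)
      finally show ?thesis unfolding q_def Suc by simp
    qed
  qed simp
qed

section \<open>Theta series and the triple product identity\<close>

text \<open>For \<open>r \<le> m\<close> the exponent is nonnegative, so that \<open>nat\<close> does not truncate.\<close>
definition theta_exp :: "nat \<Rightarrow> nat \<Rightarrow> int \<Rightarrow> nat" where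
  "theta_exp m r j = nat (int m * j\<^sup>2 + int r * j)"

text \<open>Here \<open>theta k 0\<close> is \<phi> at -q^k, and \<open>theta 3 2\<close> is the
  series \<Omega> of the overview. For \<open>r \<le> m\<close> and \<open>m > 0\<close> the index
  set is finite by \<open>theta_exp_bound\<close>; a sum over an infinite set would silently be
  0.\<close>

definition theta :: "nat \<Rightarrow> nat \<Rightarrow> int fps" where
  "theta m r = Abs_fps (\<lambda>n. \<Sum>j | theta_exp m r j = n. if even j then 1 else -1)"

text \<open>The triple product without its factor \<open>Euler_prod (2 * m) N\<close>, which is
  supplied separately.\<close>

definition Jacobi_prod :: "nat \<Rightarrow> nat \<Rightarrow> nat \<Rightarrow> int fps" where
  "Jacobi_prod m r N = (\<Prod>i<N. (1 - fps_X ^ (2 * m * i + m - r)) * (1 - fps_X ^ (2 * m * i + m + r)))"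

lemma theta_exp_lower:
  assumes "r \<le> m"
  shows "int m * (j\<^sup>2 - \<bar>j\<bar>) \<le> int m * j\<^sup>2 + int r * j" "0 \<le> int m * (j\<^sup>2 - \<bar>j\<bar>)"
proof -
  have "int r * \<bar>j\<bar> \<le> int m * \<bar>j\<bar>" using assms by (intro mult_right_mono) auto
  moreover have "- (int r * \<bar>j\<bar>) \<le> int r * j"
    by (metis abs_ge_minus_self abs_mult abs_of_nat minus_le_iff)
  ultimately show "int m * (j\<^sup>2 - \<bar>j\<bar>) \<le> int m * j\<^sup>2 + int r * j"
    by (simp add: algebra_simps)
  have "\<bar>j\<bar> \<le> \<bar>j\<bar> * \<bar>j\<bar>" using mult_right_mono[of 1 "\<bar>j\<bar>" "\<bar>j\<bar>"] by (cases "j = 0") auto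
  then show "0 \<le> int m * (j\<^sup>2 - \<bar>j\<bar>)"
    by (simp add: power2_eq_square)
qed

lemma int_theta_exp: "r \<le> m \<Longrightarrow> int (theta_exp m r j) = int m * j\<^sup>2 + int r * j"
  using theta_exp_lower[of r m j] by (simp add: theta_exp_def)

lemma theta_exp_bound:
  assumes "r \<le> m" "m > 0"
  shows "\<bar>j\<bar> \<le> int (theta_exp m r j) + 1"
proof -
  have "\<bar>j\<bar> - 1 \<le> j\<^sup>2 - \<bar>j\<bar>"
  proof -
    have "0 \<le> (\<bar>j\<bar> - 1)\<^sup>2" by simp
    then show ?thesis by (simp add: power2_eq_square algebra_simps)
  qed
  also have "j\<^sup>2 - \<bar>j\<bar> \<le> int m * (j\<^sup>2 - \<bar>j\<bar>)"
    using theta_exp_lower(2)[OF assms(1), of j] assms(2)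
    by (metis mult_le_cancel_right1 of_nat_0_less_iff not_le int_one_le_iff_zero_less zero_le_mult_iff)
  finally show ?thesis
    using theta_exp_lower(1)[OF assms(1), of j] int_theta_exp[OF assms(1), of j] by linarith
qed

lemma prod_lessThan_add:
  fixes f :: "nat \<Rightarrow> 'a::comm_monoid_mult"
  shows "(\<Prod>i<a + b. f i) = (\<Prod>i<a. f i) * (\<Prod>i<b. f (a + i))"
  by (induction b) (simp_all add: mult.assoc)

text \<open>This is the q-binomial theorem for \<open>2 * N\<close> factors in base
  \<open>Q\<close>. Taking monomials out of the first \<open>N\<close> factors leaves the exponents
  with \<open>m - r\<close> in reverse order, and the last \<open>N\<close> factors give those with
  \<open>m + r\<close>. The total monomial \<open>fps_X ^ s\<close> then cancels.\<close>

lemma finite_Jacobi_triple_product: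
  assumes "r \<le> m"
  shows "Jacobi_prod m r N = (\<Sum>k\<le>2 * N. (-1) ^ (N + k) *
      (fps_X ^ theta_exp m r (int k - int N) * qbinom (fps_X ^ (2 * m)) (2 * N) k))"
proof -
  define Q :: "int fps" where "Q = fps_X ^ (2 * m)"
  define y :: "int fps" where "y = fps_X ^ (2 * m * N)"
  define x :: "int fps" where "x = - (fps_X ^ (m + r))"
  define s where "s = 3 * m * N\<^sup>2 + r * N"
  have split: "(\<Prod>i<2 * N. y + x * Q ^ i) = (\<Prod>i<N. y + x * Q ^ i) * (\<Prod>i<N. y + x * Q ^ (N + i))"
    unfolding mult_2 by (rule prod_lessThan_add)
  have "y + x * Q ^ i = - (fps_X ^ (2 * m * i + m + r)) * (1 - fps_X ^ (2 * m * (N - Suc i) + m - r))"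
    if "i < N" for i
  proof -
    obtain d where d: "N = Suc i + d" using \<open>i < N\<close> by (metis less_iff_Suc_add add_Suc)
    have "2 * m * N = (2 * m * i + m + r) + (2 * m * (N - Suc i) + m - r)"
      using assms unfolding d by (simp add: algebra_simps)
    then show ?thesis
      unfolding x_def y_def Q_def
      by (simp add: power_add[symmetric] power_mult[symmetric] algebra_simps del: power_Suc)
  qed
  then have "(\<Prod>i<N. y + x * Q ^ i) =
      (\<Prod>i<N. - (fps_X ^ (2 * m * i + m + r))) * (\<Prod>i<N. 1 - fps_X ^ (2 * m * (N - Suc i) + m - r))"
    by (simp add: prod.distrib[symmetric])
  also have "(\<Prod>i<N. 1 - fps_X ^ (2 * m * (N - Suc i) + m - r)) =
      (\<Prod>i<N. 1 - fps_X ^ (2 * m * i + m - r) :: int fps)"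
    by (rule prod.nat_diff_reindex)
  also have "(\<Prod>i<N. - (fps_X ^ (2 * m * i + m + r))) = ((-1) ^ N * fps_X ^ (m * N\<^sup>2 + r * N) :: int fps)"
  proof (induction N)
    case (Suc N)
    have "m * (Suc N)\<^sup>2 + r * Suc N = (m * N\<^sup>2 + r * N) + (2 * m * N + m + r)"
      by (simp add: power2_eq_square algebra_simps)
    then show ?case using Suc by (simp add: power_add)
  qed simp
  finally have first: "(\<Prod>i<N. y + x * Q ^ i) = (-1) ^ N * fps_X ^ (m * N\<^sup>2 + r * N) *
      (\<Prod>i<N. 1 - fps_X ^ (2 * m * i + m - r))" .
  have "y + x * Q ^ (N + i) = y * (1 - fps_X ^ (2 * m * i + m + r))" for i
    unfolding x_def y_def Q_def
    by (simp add: power_add[symmetric] power_mult[symmetric] algebra_simps)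
  then have second: "(\<Prod>i<N. y + x * Q ^ (N + i)) = fps_X ^ (2 * m * N\<^sup>2) * (\<Prod>i<N. 1 - fps_X ^ (2 * m * i + m + r))"
    by (simp add: prod.distrib y_def power_mult[symmetric] power2_eq_square mult.assoc)
  have "(\<Prod>i<2 * N. y + x * Q ^ i) = fps_X ^ s * ((-1) ^ N * Jacobi_prod m r N)"
    unfolding split first second Jacobi_prod_def prod.distrib s_def
    by (simp add: power_add[symmetric] algebra_simps)
  moreover have "(\<Prod>i<2 * N. y + x * Q ^ i) = fps_X ^ s * (\<Sum>k\<le>2 * N. (-1) ^ k *
      (fps_X ^ theta_exp m r (int k - int N) * qbinom Q (2 * N) k))"
    unfolding q_binomial sum_distrib_left
  proof (intro sum.cong refl)
    fix k assume "k \<in> {..2 * N}"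
    then have k: "k \<le> 2 * N" by simp
    have "int (k choose 2) * 2 = int k * int k - int k"
    proof (induction k)
      case (Suc k)
      then show ?case by (simp add: Suc_choose_two algebra_simps)
    qed (simp add: numeral_2_eq_2)
    then have kk: "2 * (int m * int (k choose 2)) = int m * (int k * int k - int k)"
      by (metis mult.assoc mult.commute)
    \<comment> \<open>The exponents are compared over the integers, where \<open>2 * N - k\<close>
      expands and twice \<open>k choose 2\<close> is \<open>k * k - k\<close>.\<close>
    have "int (2 * m * (k choose 2) + (m + r) * k + 2 * m * N * (2 * N - k)) = int (s + theta_exp m r (int k - int N))"
      unfolding of_nat_add int_theta_exp[OF assms] s_def of_nat_mult of_nat_diff[OF k]
      using kk by (simp add: power2_eq_square algebra_simps)
    then have ex: "2 * m * (k choose 2) + (m + r) * k + 2 * m * N * (2 * N - k) = s + theta_exp m r (int k - int N)"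
      by linarith
    have "x ^ k = (-1) ^ k * fps_X ^ ((m + r) * k)"
      unfolding x_def power_mult by (metis mult_minus1 power_mult_distrib)
    then have "Q ^ (k choose 2) * qbinom Q (2 * N) k * x ^ k * y ^ (2 * N - k) =
        (-1) ^ k * fps_X ^ (2 * m * (k choose 2) + (m + r) * k + 2 * m * N * (2 * N - k)) * qbinom Q (2 * N) k"
      unfolding y_def power_add Q_def power_mult[symmetric] by (simp only: ac_simps)
    then show "Q ^ (k choose 2) * qbinom Q (2 * N) k * x ^ k * y ^ (2 * N - k) =
        fps_X ^ s * ((-1) ^ k * (fps_X ^ theta_exp m r (int k - int N) * qbinom Q (2 * N) k))"
      unfolding ex power_add by (simp only: ac_simps)
  qed
  ultimately have "(-1) ^ N * Jacobi_prod m r N = (\<Sum>k\<le>2 * N. (-1) ^ k *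
      (fps_X ^ theta_exp m r (int k - int N) * qbinom Q (2 * N) k))"
    by simp
  then have "(-1) ^ N * ((-1) ^ N * Jacobi_prod m r N) = (\<Sum>k\<le>2 * N. (-1) ^ (N + k) *
      (fps_X ^ theta_exp m r (int k - int N) * qbinom Q (2 * N) k))"
    by (simp add: sum_distrib_left power_add mult.assoc)
  then show ?thesis
    by (simp add: Q_def mult.assoc[symmetric] power_mult_distrib[symmetric])
qed

text \<open>As \<open>k\<close> and \<open>n - k\<close> both grow, the Gaussian binomial tends to
  the inverse of \<open>Euler_fun c\<close>; the square clears that denominator and leaves one
  factor.\<close>

lemma qbinom_agree:
  assumes "c > 0" "k \<le> n" "d \<le> k" "d \<le> n - k"
  shows "fps_agree (c * Suc d) (Euler_fun c ^ 2 * qbinom (fps_X ^ c) n k) (Euler_fun c)"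
proof -
  have E: "fps_agree (c * Suc d) (Euler_fun c) (Euler_prod c j)" if "d \<le> j" for j
  proof -
    have "c * Suc d \<le> c * Suc j" using that by (intro mult_le_mono) auto
    with Euler_fun_agree[OF assms(1), of j] show ?thesis by (rule fps_agree_mono)
  qed
  have "fps_agree (c * Suc d) (qbinom (fps_X ^ c) n k * (Euler_fun c * Euler_fun c))
      (qbinom (fps_X ^ c) n k * (Euler_prod c k * Euler_prod c (n - k)))"
    using assms by (intro fps_agree_mult E) auto
  also have "\<dots> = Euler_prod c n" using assms by (intro qbinom_Euler_prod)
  also have "fps_agree (c * Suc d) (Euler_prod c n) (Euler_fun c)"
    using assms by (intro fps_agree_sym[OF E]) auto
  finally show ?thesis by (simp add: power2_eq_square mult.commute)
qed

text \<open>Passage to the limit, term by term, in the finite identity. The binomials near the ends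
  of the sum are poorly approximated, but there the power of X in front is large enough to
  compensate.\<close>

theorem Jacobi_triple_product:
  assumes "r \<le> m" "m > 0"
  shows "fps_agree N (Euler_fun (2 * m) ^ 2 * Jacobi_prod m r N) (Euler_fun (2 * m) * theta m r)"
proof -
  let ?E = "Euler_fun (2 * m)"
  let ?t = "\<lambda>k. theta_exp m r (int k - int N)"
  have "?E ^ 2 * Jacobi_prod m r N = (\<Sum>k\<le>2 * N. (-1) ^ (N + k) *
      (fps_X ^ ?t k * (?E ^ 2 * qbinom (fps_X ^ (2 * m)) (2 * N) k)))"
    unfolding finite_Jacobi_triple_product[OF assms(1)] sum_distrib_left
    by (simp only: ac_simps)
  also have "fps_agree N \<dots> (\<Sum>k\<le>2 * N. (-1) ^ (N + k) * (fps_X ^ ?t k * ?E))"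
  proof (rule fps_agree_sum, rule fps_agree_mult[OF fps_agree_refl fps_agree_X_power_mult])
    fix k assume "k \<in> {..2 * N}"
    then have k: "k \<le> 2 * N" by simp
    define d where "d = min k (2 * N - k)"
    define j where "j = int k - int N"
    have d: "int d = int N - \<bar>j\<bar>" using k by (auto simp: d_def j_def min_def)
    \<comment> \<open>No integer lies strictly between 1 and 2. Expanded, this is the balance
      between the growth of the theta exponent and the loss of precision \<open>d\<close>.\<close>
    have "0 \<le> (\<bar>j\<bar> - 1) * (\<bar>j\<bar> - 2)"
      by (cases "\<bar>j\<bar> \<le> 1") (auto intro: mult_nonpos_nonpos)
    then have "2 * int N \<le> (j\<^sup>2 - \<bar>j\<bar>) + 2 * (int d + 1)"
      unfolding d by (simp add: power2_eq_square algebra_simps)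
    then have "int m * (2 * int N) \<le> int m * ((j\<^sup>2 - \<bar>j\<bar>) + 2 * (int d + 1))"
      by (intro mult_left_mono) auto
    also have "\<dots> \<le> int (?t k) + int (2 * m * Suc d)"
      using theta_exp_lower(1)[OF assms(1), of j] int_theta_exp[OF assms(1), of j]
      by (simp add: j_def algebra_simps)
    also have "int (?t k) + int (2 * m * Suc d) = int (?t k + 2 * m * Suc d)" by simp
    finally have "m * (2 * N) \<le> ?t k + 2 * m * Suc d"
      by (metis (mono_tags, lifting) of_nat_le_iff of_nat_mult of_nat_numeral)
    moreover have "N \<le> m * (2 * N)" using assms(2) by (cases m) auto
    ultimately have "N - ?t k \<le> 2 * m * Suc d" by linarith
    moreover have "fps_agree (2 * m * Suc d) (?E ^ 2 * qbinom (fps_X ^ (2 * m)) (2 * N) k) ?E"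
      using assms k by (intro qbinom_agree) (auto simp: d_def)
    ultimately show "fps_agree (N - ?t k) (?E ^ 2 * qbinom (fps_X ^ (2 * m)) (2 * N) k) ?E"
      by (rule fps_agree_mono[rotated])
  qed
  also have "(\<Sum>k\<le>2 * N. (-1) ^ (N + k) * (fps_X ^ ?t k * ?E)) = ?E * (\<Sum>k\<le>2 * N. (-1) ^ (N + k) * fps_X ^ ?t k)"
    by (simp only: sum_distrib_left ac_simps)
  also have "fps_agree N \<dots> (?E * theta m r)"
  proof (intro fps_agree_mult fps_agree_refl)
    show "fps_agree N (\<Sum>k\<le>2 * N. (-1) ^ (N + k) * fps_X ^ ?t k) (theta m r)"
      unfolding fps_agree_def
    proof (intro allI impI)
      fix n assume n: "n < N"
      have nth: "((-1) ^ i * f) $ n = (if even i then f $ n else - f $ n)" for i and f :: "int fps"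
        by auto
      have "(\<Sum>k\<le>2 * N. (-1) ^ (N + k) * fps_X ^ ?t k) $ n =
          (\<Sum>k\<in>{k\<in>{..2 * N}. ?t k = n}. if even (N + k) then 1 else - 1 :: int)"
        unfolding fps_sum_nth nth by (subst sum.inter_filter) (auto intro!: sum.cong)
      also have "\<dots> = (\<Sum>j | theta_exp m r j = n. if even j then 1 else -1)"
      \<comment> \<open>The shift \<open>k = j + N\<close> preserves the sign, as
        \<open>N + k\<close> and \<open>j\<close> have the same parity; by
        \<open>theta_exp_bound\<close> every \<open>j\<close> contributing below \<open>N\<close>
        lies in the window.\<close>
      proof (rule sum.reindex_bij_witness[where i = "\<lambda>j. nat (j + int N)" and j = "\<lambda>k. int k - int N"])
        fix j assume "j \<in> {j. theta_exp m r j = n}"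
        then have "\<bar>j\<bar> \<le> int N" and "theta_exp m r j = n"
          using theta_exp_bound[OF assms, of j] n by auto
        then show "nat (j + int N) \<in> {k \<in> {..2 * N}. ?t k = n}" "int (nat (j + int N)) - int N = j"
          by auto
      qed auto
      finally show "(\<Sum>k\<le>2 * N. (-1) ^ (N + k) * fps_X ^ ?t k) $ n = theta m r $ n"
        by (simp add: theta_def)
    qed
  qed
  finally show ?thesis .
qed

section \<open>Product formulas for the theta series\<close>

text \<open>For \<open>r = 0\<close> the two factors of \<open>Jacobi_prod\<close> coincide and run
  over the odd multiples of \<open>k\<close>; the even multiples from
  \<open>Euler_prod (2 * k)\<close> complete them to all multiples.\<close>

lemma theta_0_Euler_fun:
  assumes "k > 0"
  shows "theta k 0 * Euler_fun (2 * k) = Euler_fun k ^ 2"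
proof -
  have fin: "Jacobi_prod k 0 N * Euler_prod (2 * k) N ^ 2 = Euler_prod k (2 * N) ^ 2" for N
  proof (induction N)
    case (Suc N)
    have "Jacobi_prod k 0 (Suc N) * Euler_prod (2 * k) (Suc N) ^ 2 =
        (Jacobi_prod k 0 N * Euler_prod (2 * k) N ^ 2) *
        ((1 - fps_X ^ (2 * k * N + k)) * (1 - fps_X ^ (2 * k * Suc N))) ^ 2"
      by (simp add: Jacobi_prod_def Euler_prod_Suc power_mult_distrib power2_eq_square algebra_simps
          del: mult_Suc_right)
    also have "\<dots> = (Euler_prod k (2 * N) * (1 - fps_X ^ (k * Suc (2 * N))) * (1 - fps_X ^ (k * Suc (Suc (2 * N))))) ^ 2"
      unfolding Suc.IH power_mult_distrib by (simp add: algebra_simps)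
    also have "\<dots> = Euler_prod k (2 * Suc N) ^ 2"
      by (simp add: Euler_prod_Suc)
    finally show ?case .
  qed (simp add: Jacobi_prod_def)
  have "Euler_fun k ^ 2 = Euler_fun (2 * k) * theta k 0"
  proof (rule fps_agree_ext)
    fix N
    have "fps_agree N (Euler_fun k ^ 2) (Euler_prod k (2 * N) ^ 2)"
      using assms by (intro fps_agree_power fps_agree_sym[OF Euler_fun_agree']) auto
    also have "\<dots> = Euler_prod (2 * k) N ^ 2 * Jacobi_prod k 0 N"
      using fin[of N] by (simp add: mult.commute)
    also have "fps_agree N \<dots> (Euler_fun (2 * k) ^ 2 * Jacobi_prod k 0 N)"
      using assms by (intro fps_agree_mult fps_agree_power Euler_fun_agree') auto
    also have "fps_agree N \<dots> (Euler_fun (2 * k) * theta k 0)"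
      using assms by (intro Jacobi_triple_product) auto
    finally show "fps_agree N (Euler_fun k ^ 2) (Euler_fun (2 * k) * theta k 0)" .
  qed
  then show ?thesis by (simp add: mult.commute)
qed

text \<open>The exponents in \<open>Jacobi_prod 3 2\<close> are the numbers coprime to 6. By
  inclusion-exclusion over the divisors 2 and 3, their product is
  \<open>f\<^sub>1 f\<^sub>6 / (f\<^sub>2 f\<^sub>3)\<close>.\<close>

lemma theta_3_2_Euler_fun: "theta 3 2 * (Euler_fun 2 * Euler_fun 3) = Euler_fun 1 * Euler_fun 6 ^ 2"
proof -
  have fin: "Jacobi_prod 3 2 N * (Euler_prod 2 (3 * N) * Euler_prod 3 (2 * N)) = Euler_prod 1 (6 * N) * Euler_prod 6 N" for N
  proof (induction N)
    case (Suc N)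
    have S: "3 * Suc N = Suc (Suc (Suc (3 * N)))" "2 * Suc N = Suc (Suc (2 * N))"
      "6 * Suc N = Suc (Suc (Suc (Suc (Suc (Suc (6 * N))))))" by simp_all
    have e: "Suc (6 * N) = 6 * N + 1" "Suc (6 * N + 1) = 6 * N + 2" "Suc (6 * N + 2) = 6 * N + 3"
      "Suc (6 * N + 3) = 6 * N + 4" "Suc (6 * N + 4) = 6 * N + 5" "Suc (6 * N + 5) = 6 * N + 6"
      and e': "2 * Suc (3 * N) = 6 * N + 2" "2 * Suc (Suc (3 * N)) = 6 * N + 4"
      "2 * Suc (Suc (Suc (3 * N))) = 6 * N + 6" "3 * Suc (2 * N) = 6 * N + 3"
      "3 * Suc (Suc (2 * N)) = 6 * N + 6" "6 * Suc N = 6 * N + 6" by simp_all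
    \<comment> \<open>One induction step adds a full period of exponents modulo 6, the factors
      \<open>A 1\<close> to \<open>A 6\<close>.\<close>
    define A where "A i = 1 - (fps_X ^ (6 * N + i) :: int fps)" for i
    have "Jacobi_prod 3 2 (Suc N) = Jacobi_prod 3 2 N * (A 1 * A 5)"
      by (simp add: Jacobi_prod_def A_def)
    moreover have "Euler_prod 2 (3 * Suc N) = Euler_prod 2 (3 * N) * (A 2 * A 4 * A 6)"
      unfolding S(1) Euler_prod_Suc e' A_def by (simp only: mult.assoc)
    moreover have "Euler_prod 3 (2 * Suc N) = Euler_prod 3 (2 * N) * (A 3 * A 6)"
      unfolding S(2) Euler_prod_Suc e' A_def by (simp only: mult.assoc)
    moreover have "Euler_prod 6 (Suc N) = Euler_prod 6 N * A 6"
      unfolding Euler_prod_Suc e' A_def ..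
    moreover have "Euler_prod 1 (6 * Suc N) = Euler_prod 1 (6 * N) * (A 1 * A 2 * A 3 * A 4 * A 5 * A 6)"
      unfolding S(3) Euler_prod_Suc mult_1 unfolding e A_def by (simp only: mult.assoc)
    ultimately have "Jacobi_prod 3 2 (Suc N) * (Euler_prod 2 (3 * Suc N) * Euler_prod 3 (2 * Suc N)) =
        (Jacobi_prod 3 2 N * (Euler_prod 2 (3 * N) * Euler_prod 3 (2 * N))) * (A 1 * A 5 * (A 2 * A 4 * A 6) * (A 3 * A 6))"
      "Euler_prod 1 (6 * Suc N) * Euler_prod 6 (Suc N) =
        (Euler_prod 1 (6 * N) * Euler_prod 6 N) * (A 1 * A 5 * (A 2 * A 4 * A 6) * (A 3 * A 6))"
      by (simp_all only: ac_simps)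
    then show ?case unfolding Suc.IH by simp
  qed (simp add: Jacobi_prod_def)
  have "Euler_fun 6 * (theta 3 2 * (Euler_fun 2 * Euler_fun 3)) = Euler_fun 6 * (Euler_fun 1 * Euler_fun 6 ^ 2)"
  proof (rule fps_agree_ext)
    fix N
    have "Euler_fun 6 * (theta 3 2 * (Euler_fun 2 * Euler_fun 3)) =
        (Euler_fun (2 * 3) * theta 3 2) * (Euler_fun 2 * Euler_fun 3)"
      by (simp add: mult.assoc)
    also have "fps_agree N \<dots> (Euler_fun (2 * 3) ^ 2 * Jacobi_prod 3 2 N * (Euler_prod 2 (3 * N) * Euler_prod 3 (2 * N)))"
      by (intro fps_agree_mult fps_agree_sym[OF Jacobi_triple_product]
          fps_agree_sym[OF Euler_fun_agree']) auto
    also have "\<dots> = Euler_fun 6 ^ 2 * (Euler_prod 1 (6 * N) * Euler_prod 6 N)"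
      unfolding fin[symmetric] by (simp add: mult.assoc)
    also have "fps_agree N \<dots> (Euler_fun 6 ^ 2 * (Euler_fun 1 * Euler_fun 6))"
      by (intro fps_agree_mult Euler_fun_agree' fps_agree_refl) auto
    also have "\<dots> = Euler_fun 6 * (Euler_fun 1 * Euler_fun 6 ^ 2)"
      by (simp add: power2_eq_square)
    finally show "fps_agree N (Euler_fun 6 * (theta 3 2 * (Euler_fun 2 * Euler_fun 3))) (Euler_fun 6 * (Euler_fun 1 * Euler_fun 6 ^ 2))" .
  qed
  then show ?thesis by simp
qed

section \<open>Trisection of power series\<close>

definition trisect :: "nat \<Rightarrow> 'a::zero fps \<Rightarrow> 'a fps" where
  "trisect r f = Abs_fps (\<lambda>n. f $ (3 * n + r))"

lemma trisect_nth [simp]: "trisect r f $ n = f $ (3 * n + r)"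
  by (simp add: trisect_def)

lemma trisect_dilate:
  fixes f :: "int fps"
  shows "trisect 0 (f oo fps_X ^ 3) = f" "trisect 1 (f oo fps_X ^ 3) = 0" "trisect 2 (f oo fps_X ^ 3) = 0"
  by (auto simp: fps_eq_iff fps_nth_compose_X_power; presburger)+

lemma trisect_decompose:
  fixes f :: "int fps"
  shows "f = (trisect 0 f oo fps_X ^ 3) + fps_X * (trisect 1 f oo fps_X ^ 3) + fps_X ^ 2 * (trisect 2 f oo fps_X ^ 3)"
proof (rule fps_ext)
  fix n :: nat
  have "\<exists>m. n = 3 * m \<or> n = 3 * m + 1 \<or> n = 3 * m + 2" by presburger
  then obtain m where "n = 3 * m \<or> n = 3 * m + 1 \<or> n = 3 * m + 2" ..
  moreover have "\<not> 3 dvd 3 * m + 1" "\<not> 3 dvd 3 * m + 2" "m > 0 \<Longrightarrow> \<not> 3 dvd 3 * m - 1"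
     "m > 0 \<Longrightarrow> \<not> 3 dvd 3 * m - 2"
    by presburger+
  ultimately show "f $ n = ((trisect 0 f oo fps_X ^ 3) + fps_X * (trisect 1 f oo fps_X ^ 3) + fps_X ^ 2 * (trisect 2 f oo fps_X ^ 3)) $ n"
    by (elim disjE) (auto simp: fps_nth_compose_X_power fps_X_power_mult_nth)
qed

lemma trisect_recompose:
  fixes a b c :: "int fps"
  defines "f \<equiv> (a oo fps_X ^ 3) + fps_X * (b oo fps_X ^ 3) + fps_X ^ 2 * (c oo fps_X ^ 3)"
  shows "trisect 0 f = a" "trisect 1 f = b" "trisect 2 f = c"
proof -
  have "\<not> 3 dvd 3 * m + 1" "\<not> 3 dvd 3 * m + 2" "m > 0 \<Longrightarrow> \<not> 3 dvd 3 * m - 1"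
     "m > 0 \<Longrightarrow> \<not> 3 dvd 3 * m - 2" for m :: nat
    by presburger+
  then show "trisect 0 f = a" "trisect 1 f = b" "trisect 2 f = c"
    by (auto simp: fps_eq_iff f_def fps_nth_compose_X_power fps_X_power_mult_nth)
qed

text \<open>A product of two sections whose residues sum to 3 or more wraps around; the surplus cube
  becomes one factor \<open>fps_X\<close>.\<close>

lemma trisect_mult:
  fixes f g :: "int fps"
  shows "trisect 0 (f * g) = trisect 0 f * trisect 0 g + fps_X * (trisect 1 f * trisect 2 g + trisect 2 f * trisect 1 g)"
    and "trisect 1 (f * g) = trisect 0 f * trisect 1 g + trisect 1 f * trisect 0 g + fps_X * (trisect 2 f * trisect 2 g)"
    and "trisect 2 (f * g) = trisect 0 f * trisect 2 g + trisect 1 f * trisect 1 g + trisect 2 f * trisect 0 g"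
proof -
  let ?d = "\<lambda>h :: int fps. h oo fps_X ^ 3"
  let ?a = "trisect 0 f * trisect 0 g + fps_X * (trisect 1 f * trisect 2 g + trisect 2 f * trisect 1 g)"
  let ?b = "trisect 0 f * trisect 1 g + trisect 1 f * trisect 0 g + fps_X * (trisect 2 f * trisect 2 g)"
  let ?c = "trisect 0 f * trisect 2 g + trisect 1 f * trisect 1 g + trisect 2 f * trisect 0 g"
  have "f * g = ?d ?a + fps_X * ?d ?b + fps_X ^ 2 * ?d ?c"
    by (subst trisect_decompose[of f], subst trisect_decompose[of g])
      (simp add: fps_compose_add_distrib fps_compose_mult_distrib algebra_simps power2_eq_square power3_eq_cube)
  then show "trisect 0 (f * g) = ?a" "trisect 1 (f * g) = ?b" "trisect 2 (f * g) = ?c"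
    by (simp_all only: trisect_recompose)
qed

section \<open>The cubic norm of a series\<close>

text \<open>
  The product of \<open>f(q)\<close>, \<open>f(\<omega>q)\<close> and \<open>f(\<omega>\<^sup>2q)\<close> for a primitive cube root of unity \<open>\<omega>\<close> is a series in \<open>q\<^sup>3\<close>;
  this is that series with \<open>q\<^sup>3\<close> replaced by \<open>q\<close>, written without \<open>\<omega>\<close>.
\<close>
definition tri_norm :: "int fps \<Rightarrow> int fps" where
  "tri_norm f = trisect 0 f ^ 3 + fps_X * trisect 1 f ^ 3 + fps_X ^ 2 * trisect 2 f ^ 3
     - 3 * fps_X * trisect 0 f * trisect 1 f * trisect 2 f"

text \<open>Multiplicativity of the norm form for adjoining a cube root of \<open>x\<close>: the
  left arguments are the coordinates of the product of two elements.\<close>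

lemma tri_norm_identity:
  fixes a b c d e f x :: "'a::idom"
  shows "(a * d + x * (b * f + c * e)) ^ 3 + x * (a * e + b * d + x * (c * f)) ^ 3
      + x ^ 2 * (a * f + b * e + c * d) ^ 3
      - 3 * x * (a * d + x * (b * f + c * e)) * (a * e + b * d + x * (c * f)) * (a * f + b * e + c * d) =
    (a ^ 3 + x * b ^ 3 + x ^ 2 * c ^ 3 - 3 * x * a * b * c) * (d ^ 3 + x * e ^ 3 + x ^ 2 * f ^ 3 - 3 * x * d * e * f)"
  by algebra

lemma tri_norm_mult: "tri_norm (f * g) = tri_norm f * tri_norm g"
  unfolding tri_norm_def trisect_mult by (rule tri_norm_identity)

lemma tri_norm_1 [simp]: "tri_norm 1 = 1"
proof -
  have "trisect 0 (1 :: int fps) = 1" "trisect 1 (1 :: int fps) = 0" "trisect 2 (1 :: int fps) = 0"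
    by (auto simp: fps_eq_iff)
  then show ?thesis by (simp add: tri_norm_def)
qed

lemma tri_norm_power: "tri_norm (f ^ k) = tri_norm f ^ k"
  by (induction k) (simp_all add: tri_norm_mult)

lemma tri_norm_agree:
  assumes "fps_agree (3 * N) f g"
  shows "fps_agree N (tri_norm f) (tri_norm g)"
proof -
  have tri: "fps_agree N (trisect r f) (trisect r g)" if "r < 3" for r
    using assms that by (auto simp: fps_agree_def)
  have diff: "fps_agree N (f - g) (f' - g')" and add: "fps_agree N (f + g) (f' + g')"
    if "fps_agree N f f'" "fps_agree N g g'" for f g f' g'
    using that by (auto simp: fps_agree_def)
  show ?thesis unfolding tri_norm_def
    by (intro diff add fps_agree_mult fps_agree_power tri fps_agree_refl) auto
qed

text \<open>If 3 divides \<open>n\<close>, the three conjugates are equal; otherwise their product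
  is \<open>1 - fps_X ^ (3 * n)\<close>. In both cases the cube of the variable is then renamed to
  the variable.\<close>

lemma tri_norm_one_minus_X_power:
  "tri_norm (1 - fps_X ^ n) = (if 3 dvd n then (1 - fps_X ^ (n div 3)) ^ 3 else 1 - fps_X ^ n)"
proof -
  have "\<exists>d. n = 3 * d \<or> n = 3 * d + 1 \<or> n = 3 * d + 2" by presburger
  then obtain d where "n = 3 * d \<or> n = 3 * d + 1 \<or> n = 3 * d + 2" ..
  moreover have d: "\<not> 3 dvd 3 * d + 1" "\<not> 3 dvd 3 * d + 2" by presburger+
  moreover have ne: "3 * a \<noteq> 3 * b + 1" "3 * a + 1 \<noteq> 3 * b" "3 * a \<noteq> 3 * b + 2" "3 * a + 2 \<noteq> 3 * b"
     "3 * a + 1 \<noteq> 3 * b + 2" "3 * a + 2 \<noteq> 3 * b + 1" for a b :: nat by presburger+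
  moreover have "trisect 0 (1 - fps_X ^ (3 * d)) = 1 - (fps_X ^ d :: int fps)"
    "trisect 1 (1 - fps_X ^ (3 * d)) = (0 :: int fps)" "trisect 2 (1 - fps_X ^ (3 * d)) = (0 :: int fps)"
    "trisect 0 (1 - fps_X ^ (3 * d + 1)) = (1 :: int fps)"
    "trisect 1 (1 - fps_X ^ (3 * d + 1)) = - (fps_X ^ d :: int fps)"
    "trisect 2 (1 - fps_X ^ (3 * d + 1)) = (0 :: int fps)"
    "trisect 0 (1 - fps_X ^ (3 * d + 2)) = (1 :: int fps)"
    "trisect 1 (1 - fps_X ^ (3 * d + 2)) = (0 :: int fps)"
    "trisect 2 (1 - fps_X ^ (3 * d + 2)) = - (fps_X ^ d :: int fps)"
    using ne by (auto simp: fps_eq_iff simp del: One_nat_def add_2_eq_Suc' power_Suc)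
  moreover have "(fps_X ^ d) ^ 3 = (fps_X ^ (3 * d) :: int fps)"
    by (simp add: power_mult[symmetric] mult.commute)
  ultimately show ?thesis
    by (elim disjE) (simp_all add: tri_norm_def power_add power2_eq_square power_minus_odd)
qed

text \<open>The factors of index prime to 3 are fixed by the norm and contribute
  \<open>f\<^sub>k / f\<^sub>3\<^sub>k\<close>, by abuse of notation for index 3k; the remaining
  ones contribute the cube of \<open>f\<^sub>k\<close>.\<close>

lemma tri_norm_Euler_fun:
  assumes "\<not> 3 dvd k"
  shows "tri_norm (Euler_fun k) * Euler_fun (3 * k) = Euler_fun k ^ 4"
proof -
  have k: "k > 0" using assms by (cases k) auto
  have dv: "3 dvd k * j \<longleftrightarrow> 3 dvd j" for j
    using assms by (simp add: prime_dvd_mult_iff)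
  have fin: "tri_norm (Euler_prod k (3 * N)) * Euler_prod (3 * k) N = Euler_prod k (3 * N) * Euler_prod k N ^ 3" for N
  proof (induction N)
    case (Suc N)
    have S: "3 * Suc N = Suc (Suc (Suc (3 * N)))" by simp
    have n: "\<not> 3 dvd Suc (3 * N)" "\<not> 3 dvd Suc (Suc (3 * N))" "3 dvd Suc (Suc (Suc (3 * N)))"
      by presburger+
    have e: "k * Suc (Suc (Suc (3 * N))) = 3 * k * Suc N" by simp
    have e': "3 * k * Suc N div 3 = k * Suc N" by (simp only: mult.assoc)
    have "tri_norm (Euler_prod k (3 * Suc N)) = tri_norm (Euler_prod k (3 * N)) *
       ((1 - fps_X ^ (k * Suc (3 * N))) * (1 - fps_X ^ (k * Suc (Suc (3 * N)))) * (1 - fps_X ^ (k * Suc N)) ^ 3)"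
      unfolding S Euler_prod_Suc tri_norm_mult tri_norm_one_minus_X_power dv
      unfolding e e' using n by (simp add: mult.assoc del: mult_Suc_right)
    then have "tri_norm (Euler_prod k (3 * Suc N)) * Euler_prod (3 * k) (Suc N) =
       (tri_norm (Euler_prod k (3 * N)) * Euler_prod (3 * k) N) *
       ((1 - fps_X ^ (k * Suc (3 * N))) * (1 - fps_X ^ (k * Suc (Suc (3 * N)))) * (1 - fps_X ^ (k * Suc N)) ^ 3 * (1 - fps_X ^ (3 * k * Suc N)))"
      unfolding Euler_prod_Suc by (simp only: ac_simps)
    also have "\<dots> = Euler_prod k (3 * Suc N) * Euler_prod k (Suc N) ^ 3"
      unfolding S Suc.IH Euler_prod_Suc power_mult_distrib e by (simp only: ac_simps)
    finally show ?case .
  qed simp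
  show ?thesis
  proof (rule fps_agree_ext)
    fix N
    have "fps_agree N (tri_norm (Euler_fun k) * Euler_fun (3 * k)) (tri_norm (Euler_prod k (3 * N)) * Euler_prod (3 * k) N)"
      using k by (intro fps_agree_mult tri_norm_agree fps_agree_sym[OF Euler_fun_agree']) auto
    also have "\<dots> = Euler_prod k (3 * N) * Euler_prod k N ^ 3" by (rule fin)
    also have "fps_agree N \<dots> (Euler_fun k * Euler_fun k ^ 3)"
      using k by (intro fps_agree_mult fps_agree_power Euler_fun_agree') auto
    also have "\<dots> = Euler_fun k ^ 4" by (simp add: eval_nat_numeral)
    finally show "fps_agree N (tri_norm (Euler_fun k) * Euler_fun (3 * k)) (Euler_fun k ^ 4)" .
  qed
qed

lemma Euler_fun_dilate:
  assumes "k > 0"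
  shows "Euler_fun (3 * k) = Euler_fun k oo fps_X ^ 3"
proof (rule fps_agree_ext)
  fix N
  have fin: "Euler_prod (3 * k) N = Euler_prod k N oo fps_X ^ 3" for N
  proof (induction N)
    case (Suc N)
    have "fps_X ^ (3 * k * Suc N) = ((fps_X ^ (k * Suc N)) oo fps_X ^ 3 :: int fps)"
      by (simp add: fps_X_power_compose power_mult[symmetric] mult.assoc del: mult_Suc_right)
    then show ?case
      by (simp add: Suc Euler_prod_Suc fps_compose_mult_distrib fps_compose_sub_distrib del: mult_Suc_right)
  qed simp
  have "fps_agree N (Euler_fun (3 * k)) (Euler_prod (3 * k) N)"
    using assms by (intro fps_agree_sym[OF Euler_fun_agree']) auto
  also have "\<dots> = Euler_prod k N oo fps_X ^ 3" by (rule fin)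
  also have "fps_agree N \<dots> (Euler_fun k oo fps_X ^ 3)"
    unfolding fps_agree_def
  proof (intro allI impI)
    fix n assume "n < N"
    then have "n div 3 < N" by simp
    with Euler_fun_agree'[OF assms order_refl, of N]
    show "(Euler_prod k N oo fps_X ^ 3) $ n = (Euler_fun k oo fps_X ^ 3) $ n"
      by (simp add: fps_nth_compose_X_power fps_agree_def)
  qed
  finally show "fps_agree N (Euler_fun (3 * k)) (Euler_fun k oo fps_X ^ 3)" .
qed

lemma trisect_Euler_fun_power:
  assumes "k > 0"
  shows "trisect 0 (Euler_fun (3 * k) ^ j) = Euler_fun k ^ j"
    "trisect 1 (Euler_fun (3 * k) ^ j) = 0" "trisect 2 (Euler_fun (3 * k) ^ j) = 0"
  by (simp_all add: Euler_fun_dilate[OF assms] fps_compose_power trisect_dilate del: One_nat_def)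

text \<open>Writing \<open>j = 3 * i\<close> gives section 0. The indices \<open>3 * i + 1\<close>
  and \<open>- (3 * i + 1)\<close> have equal squares,
  \<open>3 * (3 * i\<^sup>2 + 2 * i) + 1\<close>, and parity opposite to \<open>i\<close>, whence
  the factor -2. No square is 2 modulo 3.\<close>

lemma trisect_theta:
  shows "trisect 0 (theta 1 0) = theta 3 0" "trisect 1 (theta 1 0) = - 2 * theta 3 2" "trisect 2 (theta 1 0) = 0"
proof -
  let ?s = "\<lambda>j::int. if even j then 1 else - 1 :: int"
  have sq: "theta_exp 1 0 j = n \<longleftrightarrow> j\<^sup>2 = int n" for j n
    by (auto simp: theta_exp_def)
  have sq3: "theta_exp 3 r j = n \<longleftrightarrow> 3 * j\<^sup>2 + int r * j = int n" if "r \<le> 3" for j n r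
    using int_theta_exp[OF that, of j] by auto
  have mod3: "(\<exists>i. j = 3 * i) \<or> (\<exists>i. j = 3 * i + 1) \<or> (\<exists>i. j = - (3 * i + 1))" for j :: int
    by presburger
  show "trisect 0 (theta 1 0) = theta 3 0"
  proof (rule fps_ext)
    fix n
    have "(\<Sum>j | j\<^sup>2 = int (3 * n). ?s j) = (\<Sum>i | 3 * i\<^sup>2 = int n. ?s i)"
    proof (rule sum.reindex_bij_witness[where i = "\<lambda>i. 3 * i" and j = "\<lambda>j. j div 3"])
      fix j assume "j \<in> {j. j\<^sup>2 = int (3 * n)}"
      then have j: "j\<^sup>2 = 3 * int n" by simp
      then have "3 dvd j\<^sup>2" by simp
      then have "3 dvd j" using prime_dvd_power_int[of 3 j 2] by simp
      then obtain i where "j = 3 * i" by auto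
      then show "3 * (j div 3) = j" "j div 3 \<in> {i. 3 * i\<^sup>2 = int n}" "?s (j div 3) = ?s j"
        using j by (auto simp: power2_eq_square)
    qed (auto simp: power2_eq_square)
    then show "trisect 0 (theta 1 0) $ n = theta 3 0 $ n"
      by (simp add: theta_def sq sq3 del: One_nat_def)
  qed
  show "trisect 1 (theta 1 0) = - 2 * theta 3 2"
  proof (rule fps_ext)
    fix n
    let ?I = "{i. 3 * i\<^sup>2 + 2 * i = int n}"
    have fin: "finite ?I"
    proof (rule finite_subset)
      show "?I \<subseteq> {- (int n + 1)..int n + 1}"
      proof
        fix i assume "i \<in> ?I"
        then have "theta_exp 3 2 i = n" by (simp add: sq3)
        with theta_exp_bound[of 2 3 i] show "i \<in> {- (int n + 1)..int n + 1}" by auto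
      qed
    qed simp
    have "{j. j\<^sup>2 = int (3 * n + 1)} = (\<lambda>i. 3 * i + 1) ` ?I \<union> (\<lambda>i. - (3 * i + 1)) ` ?I"
    proof (rule set_eqI)
      fix j
      have "(3 * i + 1)\<^sup>2 = int (3 * n + 1) \<longleftrightarrow> i \<in> ?I" for i
        by (auto simp: power2_eq_square algebra_simps)
      moreover have "(3 * i)\<^sup>2 \<noteq> int (3 * n + 1)" for i
      proof
        assume "(3 * i)\<^sup>2 = int (3 * n + 1)"
        then have "3 * (3 * i\<^sup>2) = 3 * int n + 1" by (simp add: power2_eq_square)
        then show False by presburger
      qed
      moreover have "(- (3 * i + 1))\<^sup>2 = (3 * i + 1)\<^sup>2" for i :: int by (rule power2_minus)
      ultimately show "j \<in> {j. j\<^sup>2 = int (3 * n + 1)} \<longleftrightarrow> j \<in> (\<lambda>i. 3 * i + 1) ` ?I \<union> (\<lambda>i. - (3 * i + 1)) ` ?I"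
        using mod3[of j] by (smt (verit) Un_iff imageE image_eqI mem_Collect_eq)
    qed
    then have "(\<Sum>j | j\<^sup>2 = int (3 * n + 1). ?s j) =
        (\<Sum>j\<in>(\<lambda>i. 3 * i + 1) ` ?I. ?s j) + (\<Sum>j\<in>(\<lambda>i. - (3 * i + 1)) ` ?I. ?s j)"
    proof (simp only:, intro sum.union_disjoint finite_imageI fin)
      show "(\<lambda>i. 3 * i + 1) ` ?I \<inter> (\<lambda>i. - (3 * i + 1)) ` ?I = {}"
        by (auto; presburger)
    qed
    also have "\<dots> = (\<Sum>i\<in>?I. ?s (3 * i + 1)) + (\<Sum>i\<in>?I. ?s (- (3 * i + 1)))"
      by (intro arg_cong2[where f = "(+)"]; subst sum.reindex) (auto simp: inj_on_def)
    also have "\<dots> = - 2 * (\<Sum>i\<in>?I. ?s i)"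
      unfolding sum_distrib_left sum.distrib[symmetric] by (intro sum.cong) auto
    finally show "trisect 1 (theta 1 0) $ n = (- 2 * theta 3 2) $ n"
      by (simp add: theta_def sq sq3 numeral_fps_const del: One_nat_def)
  qed
  show "trisect 2 (theta 1 0) = 0"
  proof (rule fps_ext)
    fix n
    have "j\<^sup>2 \<noteq> int (3 * n + 2)" for j
    proof
      assume "j\<^sup>2 = int (3 * n + 2)"
      then have "j\<^sup>2 mod 3 = 2" by simp
      moreover have "j mod 3 = 0 \<or> j mod 3 = 1 \<or> j mod 3 = 2" by presburger
      ultimately show False by (auto simp: power_mod[symmetric, of j])
    qed
    then show "trisect 2 (theta 1 0) $ n = (0 :: int fps) $ n"
      by (simp add: theta_def sq del: One_nat_def)
  qed
qed

section \<open>Trisection of the generating functions\<close>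

text \<open>Since \<open>d\<close> has constant term 1, coefficient \<open>n\<close> of
  \<open>u\<close> is \<open>c * w $ n\<close> minus a combination of earlier coefficients of
  \<open>u\<close>.\<close>

lemma dvd_fps_nth_of_unit_mult:
  fixes d u :: "int fps"
  assumes "d $ 0 = 1" "u * d = fps_const c * w"
  shows "c dvd u $ n"
proof (induction n rule: less_induct)
  case (less n)
  have "(d * u) $ n = u $ n + (\<Sum>i=1..n. d $ i * u $ (n - i))"
    unfolding fps_mult_nth by (subst sum.atLeast_Suc_atMost) (simp_all add: assms(1))
  moreover have "(d * u) $ n = c * w $ n"
    using assms(2) by (simp add: mult.commute)
  moreover have "c dvd (\<Sum>i=1..n. d $ i * u $ (n - i))"
    using less by (intro dvd_sum dvd_mult) auto
  ultimately show ?case by (metis dvd_add_left_iff dvd_triv_left)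
qed

text \<open>
  The two dissection lemmas solve \<open>U \<cdot> \<phi> = g(q\<^sup>3)\<close> and \<open>U \<cdot> \<phi>\<^sup>3 = g(q\<^sup>3)\<close> for the components \<open>u, v, w\<close> of \<open>U\<close>
  at exponents 0, 1, 2 modulo 3; the hypotheses are the components of these equations.
\<close>
lemma linear_dissection:
  fixes a b q g :: "'a::idom"
  assumes "u * a - q * (w * b) = g" "v * a - u * b = 0" "w * a - v * b = 0"
  shows "v * (a ^ 3 - q * b ^ 3) = a * b * g" "w * (a ^ 3 - q * b ^ 3) = b ^ 2 * g"
proof -
  \<comment> \<open>With \<open>t ^ 3 = q\<close>, the multipliers are the components of
    \<open>a\<^sup>2 + a * b * t + b\<^sup>2 * t\<^sup>2\<close>, the cofactor of
    \<open>a - b * t\<close> in \<open>a ^ 3 - q * b ^ 3\<close>.\<close>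
  have "v * (a ^ 3 - q * b ^ 3) = a * b * (u * a - q * (w * b)) + a ^ 2 * (v * a - u * b) + q * b ^ 2 * (w * a - v * b)"
    by algebra
  then show "v * (a ^ 3 - q * b ^ 3) = a * b * g" unfolding assms by simp
  have "w * (a ^ 3 - q * b ^ 3) = b ^ 2 * (u * a - q * (w * b)) + a * b * (v * a - u * b) + a ^ 2 * (w * a - v * b)"
    by algebra
  then show "w * (a ^ 3 - q * b ^ 3) = b ^ 2 * g" unfolding assms by simp
qed

lemma cubic_dissection:
  fixes a b q g :: "'a::idom"
  assumes e: "u * (a ^ 3 - q * b ^ 3) + q * (v * (3 * a * b ^ 2) + w * (- 3 * a ^ 2 * b)) = g"
    "u * (- 3 * a ^ 2 * b) + v * (a ^ 3 - q * b ^ 3) + q * (w * (3 * a * b ^ 2)) = 0"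
    "u * (3 * a * b ^ 2) + v * (- 3 * a ^ 2 * b) + w * (a ^ 3 - q * b ^ 3) = 0"
  shows "v * (a ^ 3 - q * b ^ 3) ^ 3 = g * (3 * a ^ 5 * b + 6 * q * a ^ 2 * b ^ 4)"
    "w * (a ^ 3 - q * b ^ 3) ^ 3 = g * (6 * a ^ 4 * b ^ 2 + 3 * q * a * b ^ 5)"
proof -
  let ?e0 = "u * (a ^ 3 - q * b ^ 3) + q * (v * (3 * a * b ^ 2) + w * (- 3 * a ^ 2 * b))"
  let ?e1 = "u * (- 3 * a ^ 2 * b) + v * (a ^ 3 - q * b ^ 3) + q * (w * (3 * a * b ^ 2))"
  let ?e2 = "u * (3 * a * b ^ 2) + v * (- 3 * a ^ 2 * b) + w * (a ^ 3 - q * b ^ 3)"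
  \<comment> \<open>These are the components of the cube of that cofactor,
    \<open>(a\<^sup>2 + a * b * t + b\<^sup>2 * t\<^sup>2) ^ 3\<close> with
    \<open>t ^ 3 = q\<close>.\<close>
  let ?c0 = "a ^ 6 + 7 * q * a ^ 3 * b ^ 3 + q ^ 2 * b ^ 6"
  let ?c1 = "3 * a ^ 5 * b + 6 * q * a ^ 2 * b ^ 4"
  let ?c2 = "6 * a ^ 4 * b ^ 2 + 3 * q * a * b ^ 5"
  have "v * (a ^ 3 - q * b ^ 3) ^ 3 = ?e0 * ?c1 + ?e1 * ?c0 + ?e2 * (q * ?c2)"
    by algebra
  then show "v * (a ^ 3 - q * b ^ 3) ^ 3 = g * ?c1" unfolding e by simp
  have "w * (a ^ 3 - q * b ^ 3) ^ 3 = ?e0 * ?c2 + ?e1 * ?c1 + ?e2 * ?c0"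
    by algebra
  then show "w * (a ^ 3 - q * b ^ 3) ^ 3 = g * ?c2" unfolding e by simp
qed

lemma theta_1_0_Euler_fun: "theta 1 0 * Euler_fun 2 = Euler_fun 1 ^ 2"
  using theta_0_Euler_fun[of 1] by simp

lemma theta_3_0_Euler_fun: "theta 3 0 * Euler_fun 6 = Euler_fun 3 ^ 2"
  using theta_0_Euler_fun[of 3] by simp

lemma theta_3_0_nth_0: "theta 3 0 $ 0 = 1"
  using arg_cong[OF theta_3_0_Euler_fun, of "\<lambda>f. f $ 0"] by (simp add: fps_power_zeroth)

lemma tri_norm_theta: "tri_norm (theta 1 0) = theta 3 0 ^ 3 - fps_X * (2 * theta 3 2) ^ 3"
  unfolding tri_norm_def trisect_theta by (simp add: power_minus_odd)

text \<open>Taking norms in \<open>\<phi> = f\<^sub>1\<^sup>2 / f\<^sub>2\<close> gives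
  \<open>(f\<^sub>1\<^sup>8 / f\<^sub>3\<^sup>2) * (f\<^sub>6 / f\<^sub>2\<^sup>4)\<close>, which is
  \<open>\<phi>\<^sup>4\<close> divided by \<open>theta 3 0\<close>.\<close>

lemma tri_norm_theta_mult: "tri_norm (theta 1 0) * theta 3 0 = theta 1 0 ^ 4"
proof -
  let ?T = "theta 1 0" and ?a = "theta 3 0"
  note T = theta_1_0_Euler_fun
  have N: "tri_norm ?T * tri_norm (Euler_fun 2) = tri_norm (Euler_fun 1) ^ 2"
    unfolding tri_norm_mult[symmetric] T tri_norm_power ..
  have "tri_norm ?T * ?a * (Euler_fun 6 * Euler_fun 2 ^ 4) =
      tri_norm ?T * (tri_norm (Euler_fun 2) * Euler_fun (3 * 2)) * (?a * Euler_fun 6)"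
    by (subst tri_norm_Euler_fun) (simp_all add: ac_simps)
  also have "\<dots> = (tri_norm (Euler_fun 1) * Euler_fun (3 * 1)) ^ 2 * Euler_fun 6"
    unfolding theta_3_0_Euler_fun power_mult_distrib N[symmetric] by (simp add: ac_simps)
  also have "\<dots> = (Euler_fun 1 ^ 2) ^ 4 * Euler_fun 6"
    by (subst tri_norm_Euler_fun) (simp_all add: power_mult[symmetric])
  also have "\<dots> = ?T ^ 4 * (Euler_fun 6 * Euler_fun 2 ^ 4)"
    unfolding T[symmetric] power_mult_distrib by (simp add: ac_simps)
  finally show ?thesis by simp
qed

lemma trisect_theta_cube:
  "trisect 0 (theta 1 0 ^ 3) = theta 3 0 ^ 3 - fps_X * (2 * theta 3 2) ^ 3"
  "trisect 1 (theta 1 0 ^ 3) = - 3 * theta 3 0 ^ 2 * (2 * theta 3 2)"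
  "trisect 2 (theta 1 0 ^ 3) = 3 * theta 3 0 * (2 * theta 3 2) ^ 2"
  unfolding power3_eq_cube trisect_mult trisect_theta by (simp_all add: power2_eq_square algebra_simps)

lemma dvd_trisect_of_theta_cube:
  assumes "u * theta 1 0 ^ 3 = fps_const c * Euler_fun (3 * k) ^ 3" "k > 0"
  shows "6 * c dvd trisect 1 u $ n" "24 * c dvd trisect 2 u $ n"
proof -
  let ?a = "theta 3 0" and ?w = "theta 3 2"
  let ?D = "?a ^ 3 - fps_X * (2 * ?w) ^ 3"
  have cE: "trisect r (fps_const c * f) = fps_const c * trisect r f" for r f
    by (simp add: fps_eq_iff)
  have D0: "(?D ^ 3) $ 0 = 1"
    by (simp add: fps_power_zeroth theta_3_0_nth_0)
  have secs: "trisect 0 (u * theta 1 0 ^ 3) = fps_const c * Euler_fun k ^ 3"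
    "trisect 1 (u * theta 1 0 ^ 3) = 0" "trisect 2 (u * theta 1 0 ^ 3) = 0"
    unfolding assms(1) cE trisect_Euler_fun_power[OF assms(2)] by simp_all
  note cubic = cubic_dissection[OF secs[unfolded trisect_mult trisect_theta_cube]]
  \<comment> \<open>The substitution \<open>b = 2 * ?w\<close> makes the coefficients 3 and 6 into 6
    and 96; in section 2 below, 6 and 3 become 24 and 96.\<close>
  have "trisect 1 u * ?D ^ 3 = fps_const (6 * c) * (Euler_fun k ^ 3 * (?a ^ 5 * ?w + 16 * fps_X * ?a ^ 2 * ?w ^ 4))"
    unfolding cubic(1) fps_const_mult[symmetric] by (simp add: numeral_fps_const[symmetric] power_mult_distrib algebra_simps)
  then show "6 * c dvd trisect 1 u $ n" by (rule dvd_fps_nth_of_unit_mult[OF D0])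
  have "trisect 2 u * ?D ^ 3 = fps_const (24 * c) * (Euler_fun k ^ 3 * (?a ^ 4 * ?w ^ 2 + 4 * fps_X * ?a * ?w ^ 5))"
    unfolding cubic(2) fps_const_mult[symmetric] by (simp add: numeral_fps_const[symmetric] power_mult_distrib algebra_simps)
  then show "24 * c dvd trisect 2 u $ n" by (rule dvd_fps_nth_of_unit_mult[OF D0])
qed

section \<open>First dissection of the overpartition series\<close>

lemma Rstar_gf_theta:
  assumes "l > 0"
  shows "Abs_fps (\<lambda>n. int (Rstar l n)) * theta 1 0 = Euler_fun l"
proof -
  have "Euler_fun 2 * (Abs_fps (\<lambda>n. int (Rstar l n)) * theta 1 0) = Euler_fun 2 * Euler_fun l"
    using Rstar_gf[OF assms] unfolding theta_1_0_Euler_fun[symmetric] by (simp add: ac_simps)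
  then show ?thesis by simp
qed

lemma trisect_Rstar_gf:
  fixes k :: nat
  defines "R \<equiv> Abs_fps (\<lambda>n. int (Rstar (3 * k) n))"
  assumes "k > 0"
  shows "trisect 1 R * theta 1 0 ^ 4 = 2 * theta 3 0 ^ 2 * theta 3 2 * Euler_fun k"
    "trisect 2 R * theta 1 0 ^ 4 = 4 * theta 3 0 * theta 3 2 ^ 2 * Euler_fun k"
proof -
  let ?a = "theta 3 0" and ?w = "theta 3 2"
  have R: "R * theta 1 0 = Euler_fun (3 * k)"
    unfolding R_def using assms by (intro Rstar_gf_theta) auto
  have "trisect 0 R * ?a - fps_X * (trisect 2 R * (2 * ?w)) = Euler_fun k"
    "trisect 1 R * ?a - trisect 0 R * (2 * ?w) = 0" "trisect 2 R * ?a - trisect 1 R * (2 * ?w) = 0"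
    using trisect_mult[of R "theta 1 0"] trisect_Euler_fun_power[OF assms(2), of 1]
    unfolding R trisect_theta by (simp_all add: algebra_simps)
  note linear_dissection[OF this]
  \<comment> \<open>The extra factor \<open>?a\<close> turns the denominator, the norm of
    \<open>theta 1 0\<close>, into \<open>theta 1 0 ^ 4\<close>.\<close>
  then have "trisect 1 R * (tri_norm (theta 1 0) * ?a) = ?a * (2 * ?w) * Euler_fun k * ?a"
    "trisect 2 R * (tri_norm (theta 1 0) * ?a) = (2 * ?w) ^ 2 * Euler_fun k * ?a"
    unfolding mult.assoc[symmetric] tri_norm_theta by simp_all
  then show "trisect 1 R * theta 1 0 ^ 4 = 2 * ?a ^ 2 * ?w * Euler_fun k"
    "trisect 2 R * theta 1 0 ^ 4 = 4 * ?a * ?w ^ 2 * Euler_fun k"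
    unfolding tri_norm_theta_mult by (simp_all add: power2_eq_square algebra_simps)
qed

text \<open>By the product formulas \<open>2 * ?a ^ 2 * theta 3 2 * Euler_fun 1\<close> equals
  \<open>2 * Euler_fun 3 ^ 3 * ?T\<close>, so one of the four theta factors cancels.\<close>

lemma trisect_Rstar_3_gf:
  "trisect 1 (Abs_fps (\<lambda>n. int (Rstar 3 n))) * theta 1 0 ^ 3 = fps_const 2 * Euler_fun (3 * 1) ^ 3"
proof -
  let ?u = "trisect 1 (Abs_fps (\<lambda>n. int (Rstar 3 n)))" and ?T = "theta 1 0" and ?a = "theta 3 0"
  note T = theta_1_0_Euler_fun
  have "?u * ?T ^ 3 * (?T * Euler_fun 2 * Euler_fun 3) = (?u * ?T ^ 4) * (Euler_fun 2 * Euler_fun 3)"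
    by (simp add: eval_nat_numeral ac_simps)
  also have "\<dots> = 2 * ?a ^ 2 * Euler_fun 1 * (theta 3 2 * (Euler_fun 2 * Euler_fun 3))"
    using trisect_Rstar_gf(1)[of 1] by (simp add: ac_simps)
  also have "\<dots> = 2 * ?a ^ 2 * Euler_fun 6 ^ 2 * (Euler_fun 1 ^ 2)"
    unfolding theta_3_2_Euler_fun by (simp add: power2_eq_square)
  also have "\<dots> = 2 * (?a * Euler_fun 6) ^ 2 * (?T * Euler_fun 2)"
    unfolding T power_mult_distrib by (simp add: mult.assoc)
  also have "\<dots> = 2 * Euler_fun 3 ^ 3 * (?T * Euler_fun 2 * Euler_fun 3)"
    unfolding theta_3_0_Euler_fun by (simp add: eval_nat_numeral ac_simps)
  finally have "?u * ?T ^ 3 = 2 * Euler_fun 3 ^ 3"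
    using T by auto
  then show ?thesis by (simp add: numeral_fps_const)
qed

text \<open>Likewise \<open>4 * ?a * theta 3 2 ^ 2 * Euler_fun 2\<close> equals
  \<open>4 * Euler_fun 6 ^ 3 * ?T\<close>.\<close>

lemma trisect_Rstar_6_gf:
  "trisect 2 (Abs_fps (\<lambda>n. int (Rstar 6 n))) * theta 1 0 ^ 3 = fps_const 4 * Euler_fun (3 * 2) ^ 3"
proof -
  let ?u = "trisect 2 (Abs_fps (\<lambda>n. int (Rstar 6 n)))" and ?T = "theta 1 0" and ?a = "theta 3 0"
  note T = theta_1_0_Euler_fun
  have "?u * ?T ^ 3 * (?T * Euler_fun 2 * Euler_fun 3 ^ 2) = (?u * ?T ^ 4) * (Euler_fun 2 * Euler_fun 3 ^ 2)"
    by (simp add: eval_nat_numeral ac_simps)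
  also have "\<dots> = 4 * ?a * (theta 3 2 * (Euler_fun 2 * Euler_fun 3)) ^ 2"
    using trisect_Rstar_gf(2)[of 2] by (simp add: power2_eq_square ac_simps)
  also have "\<dots> = 4 * (?a * Euler_fun 6) * Euler_fun 6 ^ 3 * (Euler_fun 1 ^ 2)"
    unfolding theta_3_2_Euler_fun by (simp add: eval_nat_numeral ac_simps)
  also have "\<dots> = 4 * Euler_fun 6 ^ 3 * (?T * Euler_fun 2 * Euler_fun 3 ^ 2)"
    unfolding theta_3_0_Euler_fun T by (simp add: ac_simps)
  finally have "?u * ?T ^ 3 = 4 * Euler_fun 6 ^ 3"
    using T by auto
  then show ?thesis by (simp add: numeral_fps_const)
qed

theorem theorem1p1:
  fixes n :: nat
  shows "[Rstar 3 (9 * n + 4) = 0] (mod 12)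
       \<and> [Rstar 3 (9 * n + 7) = 0] (mod 48)
       \<and> [Rstar 6 (9 * n + 5) = 0] (mod 24)
       \<and> [Rstar 6 (9 * n + 8) = 0] (mod 96)"
proof -
  have idx: "3 * (3 * n + 1) + 1 = 9 * n + 4" "3 * (3 * n + 2) + 1 = 9 * n + 7"
    "3 * (3 * n + 1) + 2 = 9 * n + 5" "3 * (3 * n + 2) + 2 = 9 * n + 8" by simp_all
  \<comment> \<open>A second trisection gives the factors 6 and 24, multiplied by the constant 2 for
    \<open>Rstar 3\<close> and 4 for \<open>Rstar 6\<close>.\<close>
  have "int 12 dvd int (Rstar 3 (9 * n + 4))" "int 48 dvd int (Rstar 3 (9 * n + 7))"
    "int 24 dvd int (Rstar 6 (9 * n + 5))" "int 96 dvd int (Rstar 6 (9 * n + 8))"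
    using dvd_trisect_of_theta_cube[OF trisect_Rstar_3_gf, of n]
      dvd_trisect_of_theta_cube[OF trisect_Rstar_6_gf, of n]
    unfolding trisect_nth fps_nth_Abs_fps idx by simp_all
  then show ?thesis unfolding int_dvd_int_iff cong_0_iff by blast
qed

end
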